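(* Let $a\ge 1$ and $k\ge 2$ be integers and let $T=T(a,a+1,\ldots,a+k)$ be the unit arithmetic starlike tree with arm lengths $a,a+1,\ldots,a+k$. If $T$ has an odd number of vertices, then $T$ is transmission irregular.
   Context: All graphs are finite, simple and connected; $d_G(u,v)$ is the shortest-path distance. The transmission of a vertex $v$ of $G$ is ${\rm Tr}_G(v)=\sum_{u\in V(G)} d_G(u,v)$. A graph is transmission irregular if all its vertices have pairwise different transmissions. For $t\ge 3$ and positive integers $k_1\le\cdots\le k_t$, the starlike tree $T(k_1,\ldots,k_t)$ is the tree obtained by attaching to a single vertex $t$ pendant paths of lengths $k_1,\ldots,k_t$ (called the arms). It is unit arithmetic if $k_{i+1}-k_i=1$ for all $i\in\{1,\ldots,t-1\}$. The order of $T(a,\ldots,a+k)$ is $(k+1)(a+\frac k2)+1$. *)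

theory Defs
  imports "Graph_Theory.Graph_Theory"
begin

text \<open>
  A simple graph is a \<^locale>\<open>pair_graph\<close>: a finite, loopless, symmetric set of ordered pairs, so
  that each edge is represented by its two orientations. The distance is the library's weighted
  distance with all weights 1; it is \<open>ereal\<close>-valued, and infinite exactly when there is no walk.
\<close>

definition graph_dist :: "'a pair_pre_digraph \<Rightarrow> 'a \<Rightarrow> 'a \<Rightarrow> ereal" where
  "graph_dist G u v = wf_digraph.\<mu> (with_proj G) (\<lambda>_. 1) u v"

lemma graph_dist_awalk:
  assumes "pair_wf_digraph G"
  shows "graph_dist G u v =
    (INF p\<in>{p. pre_digraph.awalk (with_proj G) u p v}. ereal (real (length p)))"
proof -
  interpret pair_wf_digraph G by fact
  have "awalk_cost (\<lambda>_. 1) p = real (length p)" for p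
    by (induction p) auto
  then show ?thesis by (simp add: graph_dist_def \<mu>_def)
qed

definition transmission :: "'a pair_pre_digraph \<Rightarrow> 'a \<Rightarrow> ereal" where
  "transmission G v = (\<Sum>u\<in>pverts G. graph_dist G u v)"

definition transmission_irregular :: "'a pair_pre_digraph \<Rightarrow> bool" where
  "transmission_irregular G \<longleftrightarrow>
     (\<forall>u\<in>pverts G. \<forall>v\<in>pverts G. u \<noteq> v \<longrightarrow> transmission G u \<noteq> transmission G v)"

text \<open>
  \<open>Arm i j\<close> is the vertex at position \<open>j\<close>, counted from the centre and starting with 1, on the arm
  with index \<open>i\<close>. The arm indices start with 0, so that arm \<open>i\<close> has length \<open>ks ! i\<close>.
\<close>

datatype starlike_vertex = Center | Arm nat nat

definition starlike_edges :: "nat list \<Rightarrow> starlike_vertex rel" where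
  "starlike_edges ks =
     {(Center, Arm i 1) | i. i < length ks \<and> 1 \<le> ks ! i} \<union>
     {(Arm i j, Arm i (j + 1)) | i j. i < length ks \<and> 1 \<le> j \<and> j + 1 \<le> ks ! i}"

definition starlike_tree :: "nat list \<Rightarrow> starlike_vertex pair_pre_digraph" where
  "starlike_tree ks =
     \<lparr> pverts = {Center} \<union> {Arm i j | i j. i < length ks \<and> 1 \<le> j \<and> j \<le> ks ! i},
       parcs = starlike_edges ks \<union> (starlike_edges ks)\<inverse> \<rparr>"

lemma pverts_starlike_tree:
  "pverts (starlike_tree ks) = insert Center (\<Union>i<length ks. Arm i ` {1..ks ! i})"
  by (auto simp: starlike_tree_def)

lemma pair_graph_starlike_tree: "pair_graph (starlike_tree ks)"
proof -
  have fin: "finite (pverts (starlike_tree ks))"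
    by (simp add: pverts_starlike_tree)
  have wf: "parcs (starlike_tree ks) \<subseteq> pverts (starlike_tree ks) \<times> pverts (starlike_tree ks)"
    by (auto simp: starlike_tree_def starlike_edges_def)
  have "finite (parcs (starlike_tree ks))"
    using wf fin by (meson finite_SigmaI finite_subset)
  moreover have "sym (parcs (starlike_tree ks))"
    by (auto simp: starlike_tree_def sym_Un_converse)
  ultimately show ?thesis
    using fin wf
    by unfold_locales
      (auto simp: symmetric_def starlike_tree_def starlike_edges_def)
qed

lemma connected_starlike_tree: "connected (with_proj (starlike_tree ks))"
proof -
  interpret pair_graph "starlike_tree ks" by (rule pair_graph_starlike_tree)
  have arm: "Center \<rightarrow>\<^sup>*\<^bsub>starlike_tree ks\<^esub> Arm i (Suc j)" if "i < length ks" "Suc j \<le> ks ! i" for i j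
    using that(2)
  proof (induction j)
    case 0
    have "(Center, Arm i (Suc 0)) \<in> parcs (starlike_tree ks)"
      using that(1) 0 by (auto simp: starlike_tree_def starlike_edges_def)
    then show ?case by auto
  next
    case (Suc j)
    have "(Arm i (Suc j), Arm i (Suc (Suc j))) \<in> parcs (starlike_tree ks)"
      using that(1) Suc.prems by (auto simp: starlike_tree_def starlike_edges_def)
    then show ?case using Suc by (auto intro: reachable_adj_trans)
  qed
  have c: "Center \<rightarrow>\<^sup>*\<^bsub>starlike_tree ks\<^esub> v" if "v \<in> pverts (starlike_tree ks)" for v
  proof (cases v)
    case Center
    then show ?thesis using that by auto
  next
    case (Arm i j)
    then show ?thesis using that arm[of i "j - 1"] by (auto simp: starlike_tree_def)
  qed
  have "u \<rightarrow>\<^sup>*\<^bsub>starlike_tree ks\<^esub> v"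
    if "u \<in> pverts (starlike_tree ks)" "v \<in> pverts (starlike_tree ks)" for u v
    using c[OF that(1)] c[OF that(2)] symmetric_reachable[OF sym_arcs] reachable_trans by blast
  moreover have "Center \<in> pverts (starlike_tree ks)" by (simp add: starlike_tree_def)
  moreover have "(u, v) \<in> rtrancl_on V (R\<^sup>s)" if "(u, v) \<in> rtrancl_on V R"
    for u v :: starlike_vertex and V R
    by (rule rtrancl_on_mono[OF _ subset_refl that]) (simp add: symcl_def)
  ultimately show ?thesis
    unfolding connected_conv reachable_def with_proj_simps by blast
qed

lemma card_starlike_tree: "card (pverts (starlike_tree ks)) = sum_list ks + 1"
proof -
  have "card (\<Union>i<length ks. Arm i ` {1..ks ! i}) = (\<Sum>i<length ks. card (Arm i ` {1..ks ! i}))"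
    by (rule card_UN_disjoint) auto
  also have "\<dots> = (\<Sum>i<length ks. ks ! i)"
    by (intro sum.cong) (auto simp: card_image inj_on_def)
  also have "\<dots> = sum_list ks"
    by (simp add: sum_list_sum_nth atLeast0LessThan)
  finally have "card (\<Union>i<length ks. Arm i ` {1..ks ! i}) = sum_list ks" .
  then show ?thesis
    unfolding pverts_starlike_tree by (subst card_insert_disjoint) auto
qed

end

theory Submission
  imports Defs
begin

text \<open>
  Let \<open>S\<close> be the sum of the arm lengths. Summing the changes along an arm of length \<open>L\<close>, the vertex at
  distance \<open>j\<close> from the centre exceeds the transmission of the centre by \<open>j (S - 2 L + j)\<close>, which for
  \<open>j \<ge> 1\<close> is positive and strictly increasing in \<open>j\<close>. If this excess agrees at \<open>(L, j)\<close> and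
  \<open>(L', j')\<close> with \<open>d = L' - L > 0\<close>, then \<open>m = j' - j\<close> is positive and
  \<open>m (S - L - L') = (d - m) (j + j')\<close>. Since \<open>S\<close> is even, \<open>j\<close> and \<open>j'\<close> have the same parity, so \<open>m \<ge> 2\<close>
  and \<open>2 (S - L - L') \<le> (d - 2) (L + L')\<close>, that is \<open>2 S \<le> d (L + L')\<close>. But
  \<open>d (L + L') \<le> d (2 a + 2 k - d) \<le> k (2 a + k) < 2 S\<close>.
\<close>

section \<open>Distances in a starlike tree\<close>

text \<open>A certificate for distances to \<open>v\<close>: since \<open>h\<close> drops by at most
  1 per arc, no walk to \<open>v\<close> is shorter than \<open>h u\<close>, and following
  \<open>descent\<close> produces a walk of exactly that length.\<close>

lemma graph_dist_eqI:
  fixes h :: "'a \<Rightarrow> nat"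
  assumes "pair_wf_digraph G"
    and u: "u \<in> pverts G" and v: "v \<in> pverts G"
    and zero: "h v = 0"
    and lipschitz: "\<And>x y. (x, y) \<in> parcs G \<Longrightarrow> h x \<le> h y + 1"
    and descent: "\<And>x. x \<in> pverts G \<Longrightarrow> x \<noteq> v \<Longrightarrow> \<exists>y. (x, y) \<in> parcs G \<and> h x = h y + 1"
  shows "graph_dist G u v = ereal (real (h u))"
proof -
  interpret pair_wf_digraph G by fact
  have lower: "h x \<le> length p" if "awalk x p v" for x p
    using that
  proof (induction p arbitrary: x)
    case Nil
    then show ?case using zero by (simp add: awalk_Nil_iff)
  next
    case (Cons e p)
    then have "(x, snd e) \<in> parcs G" "awalk (snd e) p v"
      by (auto simp: awalk_Cons_iff)
    then show ?case using Cons.IH lipschitz by fastforce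
  qed
  have upper: "\<exists>p. awalk x p v \<and> length p = h x" if "x \<in> pverts G" for x
    using that
  proof (induction "h x" arbitrary: x)
    case 0
    then have "x = v" using descent by fastforce
    then show ?case using 0 v by (auto simp: awalk_Nil_iff intro!: exI[of _ "[]"])
  next
    case (Suc n)
    then have "x \<noteq> v" using zero by auto
    then obtain y where y: "(x, y) \<in> parcs G" "h x = h y + 1"
      using descent Suc.prems by blast
    moreover have "y \<in> pverts G" using y(1) in_arcsD2 by blast
    ultimately obtain p where "awalk y p v" "length p = h y"
      using Suc.hyps by auto
    then show ?case using y
      by (intro exI[of _ "(x, y) # p"]) (auto simp: awalk_Cons_iff)
  qed
  obtain p where p: "awalk u p v" "length p = h u" using upper u by blast
  show ?thesis
    unfolding graph_dist_awalk[OF assms(1)]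
  proof (rule antisym)
    show "(INF p\<in>{p. awalk u p v}. ereal (real (length p))) \<le> ereal (real (h u))"
      using p by (intro INF_lower2[of p]) auto
    show "ereal (real (h u)) \<le> (INF p\<in>{p. awalk u p v}. ereal (real (length p)))"
      using lower by (intro INF_greatest) auto
  qed
qed

text \<open>Subtraction on \<open>nat\<close> truncates, so the sum of the two differences is the
  absolute value.\<close>

fun starlike_dist :: "starlike_vertex \<Rightarrow> starlike_vertex \<Rightarrow> nat" where
  "starlike_dist Center Center = 0"
| "starlike_dist Center (Arm i j) = j"
| "starlike_dist (Arm i j) Center = j"
| "starlike_dist (Arm i j) (Arm i' j') = (if i = i' then (j - j') + (j' - j) else j + j')"

lemma graph_dist_starlike_tree:
  assumes u: "u \<in> pverts (starlike_tree ks)" and v: "v \<in> pverts (starlike_tree ks)"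
  shows "graph_dist (starlike_tree ks) u v = ereal (real (starlike_dist u v))"
proof (rule graph_dist_eqI[where h = "\<lambda>x. starlike_dist x v"])
  show "pair_wf_digraph (starlike_tree ks)"
    using pair_graph_starlike_tree[of ks]
    by (simp add: pair_graph_def pair_digraph_def pair_fin_digraph_def)
  show "starlike_dist v v = 0" by (cases v) auto
  show "starlike_dist x v \<le> starlike_dist y v + 1" if "(x, y) \<in> parcs (starlike_tree ks)" for x y
    using that by (cases v) (auto simp: starlike_tree_def starlike_edges_def)
  show "\<exists>y. (x, y) \<in> parcs (starlike_tree ks) \<and> starlike_dist x v = starlike_dist y v + 1"
    if x: "x \<in> pverts (starlike_tree ks)" "x \<noteq> v" for x
  proof (cases x)
    case Center
    then obtain i j where "v = Arm i j" "i < length ks" "1 \<le> j" "j \<le> ks ! i"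
      using v x by (auto simp: starlike_tree_def)
    then show ?thesis using Center
      by (intro exI[of _ "Arm i 1"]) (auto simp: starlike_tree_def starlike_edges_def)
  next
    case (Arm i j)
    then have ij: "i < length ks" "1 \<le> j" "j \<le> ks ! i"
      using x by (auto simp: starlike_tree_def)
    \<comment> \<open>Either the target lies further out on the same arm and the next step goes
      outwards, or the step goes towards the centre.\<close>
    consider j' where "v = Arm i j'" "j < j'" "j' \<le> ks ! i"
      | "\<forall>j'. v = Arm i j' \<longrightarrow> j' < j"
      using x v Arm by (cases v) (fastforce simp: starlike_tree_def)+
    then show ?thesis
    proof cases
      case (1 j')
      then show ?thesis using Arm ij
        by (intro exI[of _ "Arm i (j + 1)"]) (auto simp: starlike_tree_def starlike_edges_def)
    next
      case 2
      show ?thesis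
      \<comment> \<open>The inner neighbour of position 1 is \<open>Center\<close>;
        \<open>Arm i 0\<close> is not a vertex.\<close>
      proof (cases "j = 1")
        case True
        then show ?thesis using 2 Arm ij v
          by (intro exI[of _ Center], cases v)
            (auto simp: starlike_tree_def starlike_edges_def)
      next
        case False
        define m where "m = j - 1"
        have m: "j = m + 1" "1 \<le> m" using False ij by (auto simp: m_def)
        show ?thesis
        proof (intro exI[of _ "Arm i m"] conjI)
          show "(x, Arm i m) \<in> parcs (starlike_tree ks)"
            using Arm ij m by (auto simp: starlike_tree_def starlike_edges_def)
          show "starlike_dist x v = starlike_dist (Arm i m) v + 1"
            using 2 Arm m by (cases v) (auto simp: Suc_diff_le less_Suc_eq_le)
        qed
      qed
    qed
  qed
qed (use u v in auto)

section \<open>Transmissions along an arm\<close>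

definition starlike_transmission :: "nat list \<Rightarrow> starlike_vertex \<Rightarrow> int" where
  "starlike_transmission ks v = (\<Sum>u\<in>pverts (starlike_tree ks). int (starlike_dist u v))"

lemma transmission_starlike_tree:
  assumes "v \<in> pverts (starlike_tree ks)"
  shows "transmission (starlike_tree ks) v = ereal (of_int (starlike_transmission ks v))"
  using assms graph_dist_starlike_tree
  by (simp add: transmission_def starlike_transmission_def graph_dist_def)

text \<open>The centre counts as position 0 of every arm, so that an induction along an arm can
  start there.\<close>

definition arm_vertex :: "nat \<Rightarrow> nat \<Rightarrow> starlike_vertex" where
  "arm_vertex i j = (if j = 0 then Center else Arm i j)"

lemma pverts_starlike_tree_arm_vertexE:
  assumes "v \<in> pverts (starlike_tree ks)" and "ks \<noteq> []"
  obtains i j where "v = arm_vertex i j" "i < length ks" "j \<le> ks ! i"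
proof (cases v)
  case Center
  then show ?thesis using assms(2) by (intro that[of 0 0]) (auto simp: arm_vertex_def)
next
  case (Arm i j)
  then show ?thesis using assms(1) by (intro that[of i j]) (auto simp: arm_vertex_def starlike_tree_def)
qed

text \<open>One step outwards on an arm decreases the distance to exactly the vertices lying further out.\<close>

lemma starlike_transmission_step:
  assumes "i < length ks" "j < ks ! i"
  shows "starlike_transmission ks (arm_vertex i (Suc j)) =
    starlike_transmission ks (arm_vertex i j) + int (sum_list ks) + 1 - 2 * (int (ks ! i) - int j)"
proof -
  define V where "V = pverts (starlike_tree ks)"
  define B where "B = Arm i ` {j<..ks ! i}"
  have "finite V" by (simp add: V_def pverts_starlike_tree)
  have "B \<subseteq> V" using assms by (auto simp: B_def V_def pverts_starlike_tree)
  have "card B = ks ! i - j" by (simp add: B_def card_image inj_on_def)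
  then have cB: "int (card B) = int (ks ! i) - int j" using assms by simp
  have "int (starlike_dist u (arm_vertex i (Suc j))) - int (starlike_dist u (arm_vertex i j)) =
      1 - 2 * (if u \<in> B then 1 else 0)" if "u \<in> V" for u
    using that by (cases u) (auto simp: B_def V_def arm_vertex_def pverts_starlike_tree)
  then have "starlike_transmission ks (arm_vertex i (Suc j)) - starlike_transmission ks (arm_vertex i j)
      = (\<Sum>u\<in>V. 1 - 2 * (if u \<in> B then 1 else 0))"
    unfolding starlike_transmission_def V_def[symmetric] sum_subtractf[symmetric]
    by (rule sum.cong[OF refl])
  also have "\<dots> = int (card V) - 2 * (\<Sum>u\<in>V. if u \<in> B then 1 else 0)"
    by (simp add: sum_subtractf sum_distrib_left)
  also have "(\<Sum>u\<in>V. if u \<in> B then 1 else 0) = int (card (V \<inter> B))"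
    using \<open>finite V\<close> by (simp add: sum.If_cases Int_def)
  also have "V \<inter> B = B" using \<open>B \<subseteq> V\<close> by blast
  finally show ?thesis using cB by (simp add: V_def card_starlike_tree)
qed

lemma starlike_transmission_arm_vertex:
  assumes "i < length ks" "j \<le> ks ! i"
  shows "starlike_transmission ks (arm_vertex i j) =
    starlike_transmission ks Center + int j * (int (sum_list ks) - 2 * int (ks ! i) + int j)"
  using assms(2)
proof (induction j)
  case 0
  then show ?case by (simp add: arm_vertex_def)
next
  case (Suc j)
  then show ?case using starlike_transmission_step[OF assms(1), of j] by (simp add: algebra_simps)
qed

section \<open>Integer arithmetic of the excesses\<close>

lemma sum_list_upt: "2 * int (sum_list [a..<a + k + 1]) = (int k + 1) * (2 * int a + int k)"
  by (induction k) (simp_all add: algebra_simps)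

text \<open>No arm is longer than \<open>S / 2\<close>; equality does occur, for arms 1, 2, 3, and
  there \<open>1 \<le> j\<close> gives strictness.\<close>

lemma arm_excess_pos:
  fixes a k L j :: int
  assumes "1 \<le> a" "2 \<le> k" "L \<le> a + k" "1 \<le> j"
    and S: "2 * S = (k + 1) * (2 * a + k)"
  shows "0 < S - 2 * L + j"
proof -
  have "0 \<le> (k - 2) * (2 * a + k - 1)" using assms by simp
  then have "2 * S \<ge> 4 * (a + k) - 2 + 2 * a"
    using S by (simp add: algebra_simps)
  then show ?thesis using assms(1,3,4) by (simp add: algebra_simps)
qed

lemma arm_excess_inj_aux:
  fixes a k L L' j j' :: int
  assumes a: "1 \<le> a" and k: "2 \<le> k" and L: "a \<le> L" "L < L'" "L' \<le> a + k"
    and j: "1 \<le> j" "j \<le> L" and j': "1 \<le> j'" "j' \<le> L'"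
    and S: "2 * S = (k + 1) * (2 * a + k)" and even: "even S"
  shows "j * (S - 2 * L + j) \<noteq> j' * (S - 2 * L' + j')"
proof
  assume eq: "j * (S - 2 * L + j) = j' * (S - 2 * L' + j')"
  define d where "d = L' - L"
  define m where "m = j' - j"
  have pos: "0 < S - 2 * L' + j'" using arm_excess_pos a k L j' S by blast
  \<comment> \<open>For even \<open>S\<close>, the excess is congruent to \<open>j * j\<close>,
    hence to \<open>j\<close>, modulo 2.\<close>
  have "even j = even j'"
    using arg_cong[OF eq, of even] even by auto
  then have "even m" by (simp add: m_def)
  have "j < j'"
  proof (rule ccontr)
    assume "\<not> j < j'"
    then have "j' * (S - 2 * L' + j') \<le> j * (S - 2 * L' + j')"
      using pos by (intro mult_right_mono) auto
    also have "\<dots> < j * (S - 2 * L + j)"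
      using \<open>\<not> j < j'\<close> L j by (intro mult_strict_left_mono) auto
    finally show False using eq by simp
  qed
  then have m: "2 \<le> m" using \<open>even m\<close> m_def by presburger
  \<comment> \<open>Uses \<open>2 * (L' * j' - L * j) = m * (L + L') + d * (j + j')\<close>.\<close>
  have key: "m * (S - L - L') = (d - m) * (j + j')"
    using eq by (simp add: m_def d_def algebra_simps)
  \<comment> \<open>The product is \<open>k * (2 * a + k) - d * (2 * a + 2 * k - d)\<close>; the
    next one bounds \<open>L + L' = 2 * L' - d\<close> by \<open>2 * a + 2 * k - d\<close>.\<close>
  have "0 \<le> (k - d) * (2 * a + k - d)" using L a by (simp add: d_def)
  moreover have "0 \<le> d * (2 * (a + k - L'))" using L by (simp add: d_def)
  ultimately have "d * (L + L') < 2 * S"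
    using S a k by (simp add: d_def algebra_simps)
  then have large: "(d - 2) * (L + L') < 2 * (S - L - L')" by (simp add: algebra_simps)
  \<comment> \<open>The product equals \<open>2 * S - 2 * (2 * (a + k) - 1)\<close>, and two
    different arm lengths add up to at most \<open>2 * (a + k) - 1\<close>.\<close>
  have "0 \<le> (k - 1) * (2 * a + k - 2)" using a k by simp
  then have nonneg: "0 \<le> S - L - L'" using S L by (simp add: algebra_simps)
  then have "0 \<le> (d - m) * (j + j')" using m by (simp flip: key)
  then have d: "2 \<le> d" using j j' m by (simp add: zero_le_mult_iff)
  have "2 * (S - L - L') \<le> m * (S - L - L')"
    using m nonneg by (intro mult_right_mono) auto
  also have "\<dots> = (d - m) * (j + j')" by (rule key)
  also have "\<dots> \<le> (d - 2) * (j + j')" using m j j' by (intro mult_right_mono) auto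
  also have "\<dots> \<le> (d - 2) * (L + L')" using d j j' by (intro mult_left_mono) auto
  finally show False using large by simp
qed

text \<open>The excess vanishes only at the centre, which belongs to all arms; hence the alternative
  \<open>j = 0\<close> to equal lengths.\<close>

lemma arm_excess_inj:
  fixes a k L L' j j' :: int
  assumes a: "1 \<le> a" and k: "2 \<le> k" and L: "a \<le> L" "L \<le> a + k" and L': "a \<le> L'" "L' \<le> a + k"
    and j: "0 \<le> j" "j \<le> L" and j': "0 \<le> j'" "j' \<le> L'"
    and S: "2 * S = (k + 1) * (2 * a + k)" and even: "even S"
    and eq: "j * (S - 2 * L + j) = j' * (S - 2 * L' + j')"
  shows "j = j' \<and> (L = L' \<or> j = 0)"
proof -
  have pos: "0 < x * (S - 2 * M + x)" if "M \<le> a + k" "1 \<le> x" for M x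
    using arm_excess_pos[OF a k that S] that by simp
  consider "j = 0" | "j' = 0" | "1 \<le> j" "1 \<le> j'" using j j' by linarith
  then show ?thesis
  proof cases
    case 1
    then show ?thesis using pos[of L' j'] L' j' eq by fastforce
  next
    case 2
    then show ?thesis using pos[of L j] L j eq by fastforce
  next
    case 3
    then have "L = L'"
      using arm_excess_inj_aux[of a k L L' j j' S] arm_excess_inj_aux[of a k L' L j' j S] assms
      by fastforce
    \<comment> \<open>On a single arm the difference of the excesses factors, and the second factor
      is positive.\<close>
    moreover have "(j - j') * ((S - 2 * L + j) + j') = 0"
      using eq \<open>L = L'\<close> by (simp add: algebra_simps)
    then have "j = j'" using arm_excess_pos[OF a k L(2) 3(1) S] 3 by simp
    ultimately show ?thesis by simp
  qed
qed

theorem theorem2p2: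
  fixes a k :: nat
  assumes "a \<ge> 1" and "k \<ge> 2"
    and "odd (card (pverts (starlike_tree [a..<a + k + 1])))"
  shows "transmission_irregular (starlike_tree [a..<a + k + 1])"
  unfolding transmission_irregular_def
proof (intro ballI impI notI)
  define ks where "ks = [a..<a + k + 1]"
  have len: "length ks = k + 1" by (simp add: ks_def)
  have nth: "ks ! i = a + i" if "i < length ks" for i using that by (simp add: ks_def del: upt_Suc)
  fix u v
  assume "u \<in> pverts (starlike_tree [a..<a + k + 1])" "v \<in> pverts (starlike_tree [a..<a + k + 1])"
    and ne: "u \<noteq> v"
    and eq: "transmission (starlike_tree [a..<a + k + 1]) u = transmission (starlike_tree [a..<a + k + 1]) v"
  then have uv: "u \<in> pverts (starlike_tree ks)" "v \<in> pverts (starlike_tree ks)" by (auto simp: ks_def)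
  have "ks \<noteq> []" using len by auto
  then obtain i j i' j' where u: "u = arm_vertex i j" "i < length ks" "j \<le> ks ! i"
    and v: "v = arm_vertex i' j'" "i' < length ks" "j' \<le> ks ! i'"
    using uv pverts_starlike_tree_arm_vertexE by metis
  have "starlike_transmission ks u = starlike_transmission ks v"
    using eq[folded ks_def] uv by (simp add: transmission_starlike_tree)
  then have "int j * (int (sum_list ks) - 2 * int (ks ! i) + int j) =
      int j' * (int (sum_list ks) - 2 * int (ks ! i') + int j')"
    using u v by (simp add: starlike_transmission_arm_vertex)
  \<comment> \<open>The order is \<open>sum_list ks + 1\<close>.\<close>
  moreover have "even (int (sum_list ks))"
    using assms(3)[folded ks_def] by (simp add: card_starlike_tree)
  moreover have "2 * int (sum_list ks) = (int k + 1) * (2 * int a + int k)"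
    unfolding ks_def by (rule sum_list_upt)
  ultimately have "int j = int j' \<and> (int (ks ! i) = int (ks ! i') \<or> int j = 0)"
    using assms(1,2) u v nth len by (intro arm_excess_inj[of a k]) auto
  \<comment> \<open>Arm lengths \<open>a + i\<close> determine the index \<open>i\<close>, and at
    position 0 both vertices are \<open>Center\<close>.\<close>
  then show False using ne u v nth by (auto simp: arm_vertex_def)
qed

end
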